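(* Let $\mathsf H=\mathsf H_1\times\cdots\times\mathsf H_N$ with $\mathsf H_n=\mathbb R^{N_n}$, and $\mathsf G=\mathsf G_1\times\cdots\times\mathsf G_M$ with $\mathsf G_m=\mathbb R^{M_m}$. Let $D:\mathsf H\to\mathsf G$ be a linear operator written in blocks $D=(D_{m,n})_{1\le m\le M,1\le n\le N}$ with $D_{m,n}:\mathsf H_n\to\mathsf G_m$, and consider the hypergraph, the distribution over $K$ workers and all the index sets and sub-operators defined in the context. Let $\alpha,\beta>0$ and assume: (i) $h:\mathsf H\to\mathbb R$ is $\lambda_h$-Lipschitz differentiable ($\lambda_h>0$); (ii) $h(x)=\sum_{k=1}^K h_k(x_k)$ and $f(x)=\sum_{k=1}^K f_k(x_k)$ with $h_k:\mathsf H_k\to\mathbb R$, $f_k:\mathsf H_k\to]-\infty,+\infty]$; (iii) $g(v)=\sum_{m=1}^M g_m(v_m)$ with $g_m:\mathsf G_m\to]-\infty,+\infty]$; (iv) $\phi_\alpha(v,u)=\sum_{m=1}^M\phi_{m,\alpha}(v_m,u_m)$ with $\phi_{m,\alpha}(v_m,u_m)=\frac{1}{2\alpha^2}\|v_m-u_m\|^2$, and $\psi_\beta(u)=\sum_{m=1}^M\frac{1}{2\beta^2}\|u_m\|^2$. Let $\gamma\in\,]0,(\lambda_h+\|D\|^2/\alpha^2)^{-1}[$, and for each $k$ let $\mathcal K_{z_k,\alpha}(v_k,z_k,u_k)$ be a transition kernel on $\mathsf G_k$ with invariant distribution $\pi_{k,\alpha}(z_k\mid v_k,u_k)\propto\exp\big(-\sum_{m\in\overline{\mathbb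 E}_k}(g_m(z_m)+\phi_{m,\alpha}(v_m,z_m-u_m))\big)$. Distributed algorithm (A). Each worker $k$ stores $x_k^{(0)}\in\mathsf H_k$, $z_k^{(0)},u_k^{(0)}\in\mathsf G_k$, and the blocks of $D$ it needs. Initialization: each worker $k$ sends $(x_n^{(0)})_{n\in\mathbb V_{(k',k)}}$ to every $k'\in\mathcal S_k$, receives $(x_n^{(0)})_{n\in\mathbb V_{(k,k')}}$ from every $k'\in\mathcal R_k$, and sets $v_k^{(0)}=(v_m^{(0)})_{m\in\overline{\mathbb E}_k}$ with $v_m^{(0)}=D_{m,k}x_k^{(0)}$ if $m\in\mathbb E_k$ and $v_m^{(0)}=D_{m,\overline{\mathcal W}_m}x^{(0)}_{\overline{\mathcal W}_m}$ if $m\in\mathbb E_{\mathcal R_k}$. Then for $t=0,1,\dots,T$, every worker $k$ (in parallel): 1. computes $d_m^{(t)}=\frac{1}{\alpha^2}\big(v_m^{(t)}-(z_m^{(t)}-u_m^{(t)})\big)$ for $m\in\overline{\mathbb E}_k$; 2. for each $k'\in\mathcal R_k$, computes $\widetilde d_{(k',k)}^{(t)}=\sum_{m\in\mathbb E_{(k,k')}}D_{m,k'}^*d_m^{(t)}$ and sends it to worker $k'$; for each $k'\in\mathcal S_k$ receives from worker $k'$ the analogous quantity $\widetilde d_{(k,k')}^{(t)}=\sum_{m\in\mathbb E_{(k',k)}}D_{m,k}^*d_m^{(t)}$; 3. sets $\delta_k^{(t)}=\sum_{m\in\overline{\mathbb E}_k}D_{m,k}^*d_m^{(t)}+\sum_{k'\in\mathcal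 S_k}\widetilde d_{(k,k')}^{(t)}$ and $x_k^{(t+1)}=\mathrm{prox}_{\gamma f_k}\big(x_k^{(t)}-\gamma\nabla h_k(x_k^{(t)})-\gamma\delta_k^{(t)}+\sqrt{2\gamma}\,w_k^{(t)}\big)$; 4. sends $(x_n^{(t+1)})_{n\in\mathbb V_{(k',k)}}$ to each $k'\in\mathcal S_k$, receives $(x_n^{(t+1)})_{n\in\mathbb V_{(k,k')}}$ from each $k'\in\mathcal R_k$, and sets $v_m^{(t+1)}=D_{m,k}x_k^{(t+1)}$ for $m\in\mathbb E_k$, $v_m^{(t+1)}=D_{m,\overline{\mathcal W}_m}x^{(t+1)}_{\overline{\mathcal W}_m}$ for $m\in\mathbb E_{\mathcal R_k}$, $v_k^{(t+1)}=(v_m^{(t+1)})_{m\in\overline{\mathbb E}_k}$; 5. draws $z_k^{(t+1)}\sim\mathcal K_{z_k,\alpha}(v_k^{(t+1)},z_k^{(t)},u_k^{(t)})$ and $u_k^{(t+1)}\sim\mathcal N\big(\frac{\beta^2}{\alpha^2+\beta^2}(z_k^{(t+1)}-v_k^{(t+1)}),\frac{\alpha^2+\beta^2}{\alpha^2\beta^2}\mathbf I\big)$. Here, for each $k$, $(w_k^{(t)})_t$ are i.i.d. standard Gaussian vectors in $\mathsf H_k$. Centralized algorithm (B). Start from $x^{(0)}\in\mathsf H$, $v^{(0)}=Dx^{(0)}$, $(z^{(0)},u^{(0)})\in\mathsf G^2$, and for $t=0,\dots,T$: $x^{(t+1)}=\mathrm{prox}_{\gamma f}\big(x^{(t)}-\gamma\nabla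 h(x^{(t)})-\gamma D^*\nabla\phi_\alpha(\cdot,z^{(t)}-u^{(t)})(v^{(t)})+\sqrt{2\gamma}\,w^{(t)}\big)$, $v^{(t+1)}=Dx^{(t+1)}$, $z^{(t+1)}\sim\mathcal K_{z,\alpha}(v^{(t+1)},z^{(t)},u^{(t)})$, $u^{(t+1)}\sim\mathcal N\big(\frac{\beta^2}{\alpha^2+\beta^2}(z^{(t+1)}-v^{(t+1)}),\frac{\alpha^2+\beta^2}{\alpha^2\beta^2}\mathbf I\big)$, where $(w^{(t)})_t$ are i.i.d. standard Gaussian in $\mathsf H$ and $\mathcal K_{z,\alpha}$ is a kernel with invariant distribution $\pi_\alpha(z\mid v,u)\propto\exp(-g(z)-\phi_\alpha(v,z-u))$. Then Algorithm (A) is equivalent to Algorithm (B): with $x^{(t)}=(x_k^{(t)})_{1\le k\le K}$, $z^{(t)}=(z_k^{(t)})_k$, $u^{(t)}=(u_k^{(t)})_k$ (blocks reassembled according to the partitions $(\mathbb V_k)_k$ and $(\overline{\mathbb E}_k)_k$), $w^{(t)}=(w_k^{(t)})_k$, and $\mathcal K_{z,\alpha}$ taken to be the product of the kernels $\mathcal K_{z_k,\alpha}$, the iterates produced by (A) follow exactly the recursion of (B); in particular $v^{(t)}=(v_k^{(t)})_k=Dx^{(t)}$ and $(\delta_k^{(t)})_k=D^*\nabla\phi_\alpha(\cdot,z^{(t)}-u^{(t)})(Dx^{(t)})$.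
   Context: Notation: for $x\in\mathsf H$, $x=(x_n)_{1\le n\le N}$ with $x_n\in\mathsf H_n$; for $v\in\mathsf G$, $v=(v_m)_{1\le m\le M}$. $\mathrm{prox}$ denotes the proximity operator, $D^*$ the adjoint of $D$, $\mathcal N(\mu,\Sigma)$ a Gaussian distribution with mean $\mu$ and covariance $\Sigma$. Hypergraph: the hyperedges are $e_m=\{n\in\{1,\dots,N\}: D_{m,n}\neq 0\}$, $m=1,\dots,M$. Distribution over workers $\{1,\dots,K\}$ ($K\le N$), chosen by the user: a partition $(\mathbb V_k)_{1\le k\le K}$ of $\{1,\dots,N\}$ (worker $k$ stores $x_k=(x_n)_{n\in\mathbb V_k}\in\mathsf H_k=\prod_{n\in\mathbb V_k}\mathsf H_n$), and for each $m$ a worker $k_m$ with $e_m\cap\mathbb V_{k_m}\neq\emptyset$. Define $\overline{\mathbb E}_k=\{m:k_m=k\}$ (a partition of $\{1,\dots,M\}$; $\mathsf G_k=\prod_{m\in\overline{\mathbb E}_k}\mathsf G_m$, $v_k=(v_m)_{m\in\overline{\mathbb E}_k}$); $\mathcal W_m=\{k\neq k_m:\exists n\in e_m\cap\mathbb V_k\}$; $\mathbb E_k=\{m:k_m=k,\ \mathcal W_m=\emptyset\}$; $\mathbb E_{(k,k')}=\{m:k_m=k,\ k'\in\mathcal W_m\}$; $\mathcal R_k=\{k'\neq k:\mathbb E_{(k,k')}\neq\emptyset\}$; $\mathcal S_k=\{k'\neq k: k\in\mathcal R_{k'}\}$; $\mathbb E_{\mathcal R_k}=\bigcup_{k'\in\mathcal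 R_k}\mathbb E_{(k,k')}=\{m:k_m=k,\ \mathcal W_m\neq\emptyset\}$; $\mathbb V_{(k,k')}=\{n\in\mathbb V_{k'}:\exists m\in\mathbb E_{(k,k')},\ n\in e_m\}$; $\mathbb V_{\overline{\mathcal W}_m}=\mathbb V_{k_m}\cup\bigcup_{k'\in\mathcal W_m}\mathbb V_{(k_m,k')}$, $x_{\overline{\mathcal W}_m}=(x_n)_{n\in\mathbb V_{\overline{\mathcal W}_m}}$. Sub-operators: $D_{m,k}=(D_{m,n})_{n\in\mathbb V_k}:\mathsf H_k\to\mathsf G_m$ and $D_{m,\overline{\mathcal W}_m}=(D_{m,n})_{n\in\mathbb V_{\overline{\mathcal W}_m}}$. Worker $k$ stores $D_{m,k}$ for $m\in\mathbb E_k$ and $D_{m,\overline{\mathcal W}_m}$ for $m\in\mathbb E_{\mathcal R_k}$. *)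

theory Defs
  imports "HOL-Analysis.Analysis"
begin

text \<open>Coordinates of H are the elements of a finite type 'h; blkH i in {1..N} tells to which
 block H_n the coordinate i belongs (so H_n = R^{N_n} with N_n = number of such coordinates).
 Likewise for G with 'g and blkG.
 A vector of a product subspace (e.g. H_k, G_k, G_m) is represented by a vector of the
 ambient space vanishing on the other coordinates.\<close>

record ('h::finite, 'g::finite) cfg =
  cN :: nat
  cM :: nat
  cK :: nat
  cblkH :: "'h \<Rightarrow> nat"
  cblkG :: "'g \<Rightarrow> nat"
  cD :: "real^'h^'g"
  cV :: "nat \<Rightarrow> nat set"
  ckm :: "nat \<Rightarrow> nat"

definition resV :: "('i::finite \<Rightarrow> nat) \<Rightarrow> nat set \<Rightarrow> real^'i \<Rightarrow> real^'i" where
  "resV blk A x = (\<chi> i. if blk i \<in> A then x$i else 0)"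

definition subsp :: "('i::finite \<Rightarrow> nat) \<Rightarrow> nat set \<Rightarrow> (real^'i) set" where
  "subsp blk A = {x. \<forall>i. blk i \<notin> A \<longrightarrow> x$i = 0}"

definition hedge :: "('h::finite,'g::finite) cfg \<Rightarrow> nat \<Rightarrow> nat set" where
  "hedge C m = {n \<in> {1..cN C}. \<exists>j i. cblkG C j = m \<and> cblkH C i = n \<and> cD C $ j $ i \<noteq> 0}"

definition Ebar :: "('h::finite,'g::finite) cfg \<Rightarrow> nat \<Rightarrow> nat set" where
  "Ebar C k = {m \<in> {1..cM C}. ckm C m = k}"

definition Wset :: "('h::finite,'g::finite) cfg \<Rightarrow> nat \<Rightarrow> nat set" where
  "Wset C m = {k \<in> {1..cK C}. k \<noteq> ckm C m \<and> (\<exists>n \<in> hedge C m. n \<in> cV C k)}"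

definition E0 :: "('h::finite,'g::finite) cfg \<Rightarrow> nat \<Rightarrow> nat set" where
  "E0 C k = {m \<in> Ebar C k. Wset C m = {}}"

definition Epair :: "('h::finite,'g::finite) cfg \<Rightarrow> nat \<Rightarrow> nat \<Rightarrow> nat set" where
  "Epair C k k' = {m \<in> Ebar C k. k' \<in> Wset C m}"

definition Rset :: "('h::finite,'g::finite) cfg \<Rightarrow> nat \<Rightarrow> nat set" where
  "Rset C k = {k' \<in> {1..cK C}. k' \<noteq> k \<and> Epair C k k' \<noteq> {}}"

definition Sset :: "('h::finite,'g::finite) cfg \<Rightarrow> nat \<Rightarrow> nat set" where
  "Sset C k = {k' \<in> {1..cK C}. k' \<noteq> k \<and> k \<in> Rset C k'}"

definition ER :: "('h::finite,'g::finite) cfg \<Rightarrow> nat \<Rightarrow> nat set" where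
  "ER C k = (\<Union>k' \<in> Rset C k. Epair C k k')"

definition Vpair :: "('h::finite,'g::finite) cfg \<Rightarrow> nat \<Rightarrow> nat \<Rightarrow> nat set" where
  "Vpair C k k' = {n \<in> cV C k'. \<exists>m \<in> Epair C k k'. n \<in> hedge C m}"

definition VW :: "('h::finite,'g::finite) cfg \<Rightarrow> nat \<Rightarrow> nat set" where
  "VW C m = cV C (ckm C m) \<union> (\<Union>k' \<in> Wset C m. Vpair C (ckm C m) k')"

definition subop :: "('h::finite,'g::finite) cfg \<Rightarrow> nat \<Rightarrow> nat set \<Rightarrow> real^'h \<Rightarrow> real^'g" where
  "subop C m A x = resV (cblkG C) {m} (cD C *v resV (cblkH C) A x)"

definition subadj :: "('h::finite,'g::finite) cfg \<Rightarrow> nat \<Rightarrow> nat set \<Rightarrow> real^'g \<Rightarrow> real^'h" where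
  "subadj C m A d = resV (cblkH C) A (transpose (cD C) *v resV (cblkG C) {m} d)"

definition grad :: "(real^'i::finite \<Rightarrow> real) \<Rightarrow> real^'i \<Rightarrow> real^'i" where
  "grad f x = (THE g. (f has_derivative (\<lambda>d. g \<bullet> d)) (at x))"

definition prox_on :: "(real^'i::finite) set \<Rightarrow> real \<Rightarrow> (real^'i \<Rightarrow> ereal) \<Rightarrow> real^'i \<Rightarrow> (real^'i) set" where
  "prox_on S \<gamma> f x = {y \<in> S. \<forall>y' \<in> S.
      f y + ereal (norm (y - x)^2 / (2*\<gamma>)) \<le> f y' + ereal (norm (y' - x)^2 / (2*\<gamma>))}"

definition phi :: "('h::finite,'g::finite) cfg \<Rightarrow> real \<Rightarrow> real^'g \<Rightarrow> real^'g \<Rightarrow> real" where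
  "phi C \<alpha> v u = (\<Sum>m = 1..cM C. norm (resV (cblkG C) {m} (v - u))^2 / (2*\<alpha>^2))"

text \<open>Distributed algorithm quantities. X k is the state x_k of worker k (at a given time),
 Z k, U k the states z_k, u_k.\<close>

definition vA :: "('h::finite,'g::finite) cfg \<Rightarrow> (nat \<Rightarrow> real^'h) \<Rightarrow> nat \<Rightarrow> real^'g" where
  "vA C X m = (let k = ckm C m in
     if m \<in> E0 C k then subop C m (cV C k) (X k)
     else subop C m (VW C m)
       (resV (cblkH C) (cV C k) (X k) + (\<Sum>k' \<in> Wset C m. resV (cblkH C) (Vpair C k k') (X k'))))"

definition vk :: "('h::finite,'g::finite) cfg \<Rightarrow> (nat \<Rightarrow> real^'h) \<Rightarrow> nat \<Rightarrow> real^'g" where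
  "vk C X k = (\<Sum>m \<in> Ebar C k. vA C X m)"

definition dA :: "('h::finite,'g::finite) cfg \<Rightarrow> real \<Rightarrow> (nat \<Rightarrow> real^'h) \<Rightarrow> (nat \<Rightarrow> real^'g)
    \<Rightarrow> (nat \<Rightarrow> real^'g) \<Rightarrow> nat \<Rightarrow> real^'g" where
  "dA C \<alpha> X Z U m = (1 / \<alpha>^2) *\<^sub>R (vA C X m - resV (cblkG C) {m} (Z (ckm C m) - U (ckm C m)))"

text \<open>dtil C .. a b = tilde d_{(a,b)} = sum over m in E_{(b,a)} of D_{m,a}^* d_m (computed by b, sent to a).\<close>
definition dtil :: "('h::finite,'g::finite) cfg \<Rightarrow> real \<Rightarrow> (nat \<Rightarrow> real^'h) \<Rightarrow> (nat \<Rightarrow> real^'g)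
    \<Rightarrow> (nat \<Rightarrow> real^'g) \<Rightarrow> nat \<Rightarrow> nat \<Rightarrow> real^'h" where
  "dtil C \<alpha> X Z U a b = (\<Sum>m \<in> Epair C b a. subadj C m (cV C a) (dA C \<alpha> X Z U m))"

definition deltaA :: "('h::finite,'g::finite) cfg \<Rightarrow> real \<Rightarrow> (nat \<Rightarrow> real^'h) \<Rightarrow> (nat \<Rightarrow> real^'g)
    \<Rightarrow> (nat \<Rightarrow> real^'g) \<Rightarrow> nat \<Rightarrow> real^'h" where
  "deltaA C \<alpha> X Z U k = (\<Sum>m \<in> Ebar C k. subadj C m (cV C k) (dA C \<alpha> X Z U m))
      + (\<Sum>k' \<in> Sset C k. dtil C \<alpha> X Z U k k')"

text \<open>Product kernel (random-mapping representation): sampler of worker k applied to the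
 G_k-blocks, with independent noises r k.\<close>
definition Kprod :: "('h::finite,'g::finite) cfg \<Rightarrow> (nat \<Rightarrow> real^'g \<Rightarrow> real^'g \<Rightarrow> real^'g \<Rightarrow> 'r \<Rightarrow> real^'g)
    \<Rightarrow> real^'g \<Rightarrow> real^'g \<Rightarrow> real^'g \<Rightarrow> (nat \<Rightarrow> 'r) \<Rightarrow> real^'g" where
  "Kprod C samp v z u r = (\<Sum>k = 1..cK C. let P = resV (cblkG C) (Ebar C k) in samp k (P v) (P z) (P u) (r k))"

end

theory Submission
  imports Defs
begin

(*
  Algorithm (A) is Algorithm (B) with every vector cut into worker blocks, so the
  equivalence is purely algebraic.  All local vectors live in disjoint coordinate blocks, hence
  a global iterate is the sum of the local ones and restricting it to a block recovers them.
  Since row block m of D only sees the nodes of the hyperedge e_m, and every node of e_m is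
  either owned by k_m or received by it, the owner computes v_m = (Dx)_m exactly.  Dually,
  D_{m,k}^* d_m vanishes unless worker k owns m or holds a node of e_m, so after exchanging
  the sums over owners and senders the delta_k add up to D^* grad phi_alpha(Dx).  Finally f and
  h are separable over the blocks, so the proximity operator and the gradient split blockwise,
  and the z-update is the product kernel by definition.
*)

(* Keeps the index ranges {1..K}, {1..M} from being rewritten to {Suc 0..K}. *)
declare One_nat_def [simp del]

section \<open>Restriction to blocks of coordinates\<close>

lemma resV_nth [simp]: "resV b A x $ i = (if b i \<in> A then x $ i else 0)"
  by (simp add: resV_def)

lemma linear_resV: "linear (resV b A)"
  by (rule linearI) (simp_all add: vec_eq_iff)

lemma bounded_linear_resV: "bounded_linear (resV b A :: real^'i::finite \<Rightarrow> _)"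
  using linear_resV linear_conv_bounded_linear by blast

lemmas resV_diff = linear_diff[OF linear_resV]
  and resV_scaleR = linear_scale[OF linear_resV]

lemma resV_resV: "resV b A (resV b B x) = resV b (A \<inter> B) x"
  by (simp add: vec_eq_iff)

lemma resV_in_subsp: "resV b A x \<in> subsp b A"
  by (simp add: subsp_def)

lemma resV_subsp_eq: "x \<in> subsp b A \<Longrightarrow> resV b A x = x"
  by (auto simp: vec_eq_iff subsp_def)

lemma resV_cover_eq: "(\<And>i. b i \<in> A) \<Longrightarrow> resV b A x = x"
  by (simp add: vec_eq_iff)

lemma subspace_subsp: "subspace (subsp b A)"
  by (simp add: subspace_def subsp_def)

lemma inner_resV: "resV b A x \<bullet> y = x \<bullet> resV b A y"
  by (auto simp: inner_vec_def intro!: sum.cong)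

lemma norm_resV_square: "norm (resV b A x) ^ 2 = resV b A x \<bullet> x"
  by (simp add: power2_norm_eq_inner inner_resV resV_resV)

lemma sum_nth_disjoint_blocks:
  assumes "finite I" "disjoint_family_on A I" "\<And>k. k \<in> I \<Longrightarrow> X k \<in> subsp b (A k)"
    and "k0 \<in> I" "b i \<in> A k0"
  shows "(\<Sum>k\<in>I. X k) $ i = X k0 $ i"
proof -
  have "(\<Sum>k\<in>{k0}. X k $ i) = (\<Sum>k\<in>I. X k $ i)"
    using assms by (intro sum.mono_neutral_left) (auto simp: subsp_def disjoint_family_on_def, blast)
  then show ?thesis by simp
qed

lemma resV_sum_disjoint_blocks:
  assumes "finite I" "disjoint_family_on A I" "\<And>k. k \<in> I \<Longrightarrow> X k \<in> subsp b (A k)" "k0 \<in> I"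
  shows "resV b (A k0) (\<Sum>k\<in>I. X k) = X k0"
  using sum_nth_disjoint_blocks[OF assms] assms(3,4) by (auto simp: vec_eq_iff subsp_def)

lemma sum_resV_disjoint:
  assumes "finite I" "disjoint_family_on A I"
  shows "(\<Sum>k\<in>I. resV b (A k) x) = resV b (\<Union>k\<in>I. A k) x"
proof (subst vec_eq_iff, intro allI)
  fix i
  show "(\<Sum>k\<in>I. resV b (A k) x) $ i = resV b (\<Union>k\<in>I. A k) x $ i"
  proof (cases "\<exists>k\<in>I. b i \<in> A k")
    case True
    then obtain k0 where "k0 \<in> I" "b i \<in> A k0" by blast
    then show ?thesis
      using sum_nth_disjoint_blocks[OF assms, of "\<lambda>k. resV b (A k) x" b k0 i] resV_in_subsp by auto
  qed auto
qed

lemma norm_square_sum_resV: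
  fixes x :: "real^'i::finite"
  assumes "finite I" "disjoint_family_on A I" "\<And>i. b i \<in> (\<Union>k\<in>I. A k)"
  shows "norm x ^ 2 = (\<Sum>k\<in>I. norm (resV b (A k) x) ^ 2)"
  using assms
  by (simp add: norm_resV_square flip: inner_sum_left)
     (simp add: sum_resV_disjoint resV_cover_eq power2_norm_eq_inner)

lemma singletons_disjoint: "disjoint_family_on (\<lambda>m. {m}) S"
  by (auto simp: disjoint_family_on_def)

section \<open>Gradients\<close>

lemma grad_eqI:
  fixes f :: "real^'i::finite \<Rightarrow> real"
  assumes "(f has_derivative (\<lambda>d. g \<bullet> d)) (at x)"
  shows "grad f x = g"
  unfolding grad_def
proof (rule the_equality)
  fix g' assume "(f has_derivative (\<lambda>d. g' \<bullet> d)) (at x)"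
  then have "(\<lambda>d. g' \<bullet> d) = (\<lambda>d. g \<bullet> d)" using assms by (rule has_derivative_unique)
  then have "(g' - g) \<bullet> (g' - g) = 0" by (metis inner_diff_left right_minus_eq)
  then show "g' = g" by simp
qed (fact assms)

lemma has_derivative_grad:
  fixes f :: "real^'i::finite \<Rightarrow> real"
  assumes "f differentiable (at x)"
  shows "(f has_derivative (\<lambda>d. grad f x \<bullet> d)) (at x)"
proof -
  obtain f' where f': "(f has_derivative f') (at x)" using assms by (auto simp: differentiable_def)
  have "f' = (\<lambda>d. adjoint f' 1 \<bullet> d)"
    using adjoint_works[OF has_derivative_linear[OF f'], of _ 1] by (auto simp: inner_commute)
  with f' show ?thesis by (metis grad_eqI)
qed

section \<open>Distribution of the hypergraph over the workers\<close>

lemma finite_Ebar [simp]: "finite (Ebar C k)" by (simp add: Ebar_def)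
lemma finite_Wset [simp]: "finite (Wset C m)" by (simp add: Wset_def)
lemma finite_Sset [simp]: "finite (Sset C k)" by (simp add: Sset_def)
lemma finite_Epair [simp]: "finite (Epair C k k')"
  by (rule finite_subset[of _ "Ebar C k"]) (auto simp: Epair_def)

locale block_partition =
  fixes C :: "('h::finite, 'g::finite) cfg"
  assumes blkH: "\<And>i. cblkH C i \<in> {1..cN C}" and blkG: "\<And>j. cblkG C j \<in> {1..cM C}"
    and V_cover: "(\<Union>k \<in> {1..cK C}. cV C k) = {1..cN C}"
    and V_disjoint: "disjoint_family_on (cV C) {1..cK C}"
    and km_worker: "\<And>m. m \<in> {1..cM C} \<Longrightarrow> ckm C m \<in> {1..cK C}"
begin

abbreviation "workers \<equiv> {1..cK C}"
abbreviation "hyperedges \<equiv> {1..cM C}"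
abbreviation "resH \<equiv> resV (cblkH C)"
abbreviation "resG \<equiv> resV (cblkG C)"
abbreviation assemble :: "(nat \<Rightarrow> 'a::comm_monoid_add) \<Rightarrow> 'a" where
  "assemble X \<equiv> sum X workers"

definition H_local :: "(nat \<Rightarrow> real^'h) \<Rightarrow> bool" where
  "H_local X \<longleftrightarrow> (\<forall>k\<in>workers. X k \<in> subsp (cblkH C) (cV C k))"

definition G_local :: "(nat \<Rightarrow> real^'g) \<Rightarrow> bool" where
  "G_local Z \<longleftrightarrow> (\<forall>k\<in>workers. Z k \<in> subsp (cblkG C) (Ebar C k))"

lemma Ebar_disjoint: "disjoint_family_on (Ebar C) S"
  by (auto simp: disjoint_family_on_def Ebar_def)

lemma worker_of_coordinate: "\<exists>k\<in>workers. cblkH C i \<in> cV C k"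
  using blkH[of i] V_cover by blast

lemma resH_assemble:
  assumes "H_local X" and "k \<in> workers"
  shows "resH (cV C k) (assemble X) = X k"
  by (rule resV_sum_disjoint_blocks[OF _ V_disjoint]) (use assms in \<open>auto simp: H_local_def\<close>)

lemma resG_assemble:
  assumes "G_local Z" and "k \<in> workers"
  shows "resG (Ebar C k) (assemble Z) = Z k"
  by (rule resV_sum_disjoint_blocks[OF _ Ebar_disjoint]) (use assms in \<open>auto simp: G_local_def\<close>)

lemma resG_edge_assemble:
  assumes Z: "G_local Z" and m: "m \<in> hyperedges"
  shows "resG {m} (assemble Z) = resG {m} (Z (ckm C m))"
proof -
  have "resG {m} (assemble Z) = resG {m} (resG (Ebar C (ckm C m)) (assemble Z))"
    using m by (simp add: resV_resV Ebar_def)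
  then show ?thesis using resG_assemble[OF Z km_worker[OF m]] by simp
qed

lemma hedgeI: "cD C $ j $ i \<noteq> 0 \<Longrightarrow> cblkH C i \<in> hedge C (cblkG C j)"
  using blkH[of i] by (auto simp: hedge_def)

lemma resG_D_hedge:
  assumes "hedge C m \<subseteq> A"
  shows "resG {m} (cD C *v resH A y) = resG {m} (cD C *v y)"
proof -
  have "cD C $ j $ i = 0" if "cblkG C j = m" "cblkH C i \<notin> A" for i j
    using hedgeI[of j i] assms that by auto
  then show ?thesis by (auto simp: vec_eq_iff matrix_vector_mult_def intro!: sum.cong)
qed

lemma resH_Dt_edge_vanish:
  assumes "A \<inter> hedge C m = {}"
  shows "resH A (transpose (cD C) *v resG {m} d) = 0"
proof -
  have "cD C $ j $ i = 0" if "cblkG C j = m" "cblkH C i \<in> A" for i j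
    using hedgeI[of j i] assms that by auto
  then show ?thesis by (auto simp: vec_eq_iff matrix_vector_mult_def transpose_def intro!: sum.neutral)
qed

lemma hedge_subset_VW:
  assumes m: "m \<in> hyperedges"
  shows "hedge C m \<subseteq> VW C m"
proof
  fix n assume n: "n \<in> hedge C m"
  then have "n \<in> {1..cN C}" by (simp add: hedge_def)
  then obtain k where k: "k \<in> workers" "n \<in> cV C k"
    using V_cover by blast
  show "n \<in> VW C m"
  proof (cases "k = ckm C m")
    case False
    then have "k \<in> Wset C m" using k n by (auto simp: Wset_def)
    moreover from this have "n \<in> Vpair C (ckm C m) k"
      using k n m by (auto simp: Vpair_def Epair_def Ebar_def)
    ultimately show ?thesis by (auto simp: VW_def)
  qed (use k in \<open>simp add: VW_def\<close>)
qed

lemma own_and_received_blocks_eq: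
  assumes X: "H_local X" and m: "m \<in> hyperedges"
  shows "resH (cV C (ckm C m)) (X (ckm C m)) + (\<Sum>k'\<in>Wset C m. resH (Vpair C (ckm C m) k') (X k'))
       = resH (VW C m) (assemble X)"
proof -
  let ?k = "ckm C m" and ?I = "insert (ckm C m) (Wset C m)"
  define B where "B j = (if j = ?k then cV C ?k else Vpair C ?k j)" for j
  have B_sub: "B j \<subseteq> cV C j" for j by (auto simp: B_def Vpair_def)
  have I: "?I \<subseteq> workers" "?k \<notin> Wset C m" using km_worker[OF m] by (auto simp: Wset_def)
  have "disjoint_family_on B ?I"
    unfolding disjoint_family_on_def
  proof (intro ballI impI)
    fix a b assume "a \<in> ?I" "b \<in> ?I" "a \<noteq> b"
    then have "cV C a \<inter> cV C b = {}" using I(1) by (intro disjoint_family_onD[OF V_disjoint]) auto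
    then show "B a \<inter> B b = {}" using B_sub by blast
  qed
  have B_local: "resH (B j) (X j) = resH (B j) (assemble X)" if "j \<in> ?I" for j
  proof -
    have "resH (B j) (assemble X) = resH (B j) (resH (cV C j) (assemble X))"
      using B_sub[of j] by (simp add: resV_resV Int_absorb2)
    also have "\<dots> = resH (B j) (X j)" using resH_assemble[OF X] I(1) that by auto
    finally show ?thesis ..
  qed
  have "resH (cV C ?k) (X ?k) + (\<Sum>k'\<in>Wset C m. resH (Vpair C ?k k') (X k'))
      = resH (B ?k) (X ?k) + (\<Sum>j\<in>Wset C m. resH (B j) (X j))"
    using I(2) by (auto simp: B_def intro!: sum.cong)
  also have "\<dots> = (\<Sum>j\<in>?I. resH (B j) (X j))"
    using I(2) by simp
  also have "\<dots> = (\<Sum>j\<in>?I. resH (B j) (assemble X))" using B_local by simp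
  also have "\<dots> = resH (\<Union>j\<in>?I. B j) (assemble X)"
    by (rule sum_resV_disjoint) (simp_all add: \<open>disjoint_family_on B ?I\<close>)
  also have "(\<Union>j\<in>?I. B j) = VW C m"
    using I(2) by (auto simp: B_def VW_def split: if_splits)
  finally show ?thesis .
qed

lemma vA_eq:
  assumes X: "H_local X" and m: "m \<in> hyperedges"
  shows "vA C X m = resG {m} (cD C *v assemble X)"
proof -
  note input = own_and_received_blocks_eq[OF X m]
  have "vA C X m = resG {m} (cD C *v resH (VW C m) (assemble X))"
  proof (cases "m \<in> E0 C (ckm C m)")
    case True
    then have "Wset C m = {}" by (simp add: E0_def)
    with True input show ?thesis by (simp add: vA_def subop_def)
  next
    case False
    with input show ?thesis by (simp add: vA_def subop_def resV_resV)
  qed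
  also have "\<dots> = resG {m} (cD C *v assemble X)"
    by (rule resG_D_hedge[OF hedge_subset_VW[OF m]])
  finally show ?thesis .
qed

lemma vk_eq:
  assumes X: "H_local X"
  shows "vk C X k = resG (Ebar C k) (cD C *v assemble X)"
proof -
  have "vk C X k = (\<Sum>m\<in>Ebar C k. resG {m} (cD C *v assemble X))"
    unfolding vk_def by (intro sum.cong refl vA_eq[OF X]) (auto simp: Ebar_def)
  also have "\<dots> = resG (\<Union>m\<in>Ebar C k. {m}) (cD C *v assemble X)"
    by (simp add: sum_resV_disjoint singletons_disjoint)
  finally show ?thesis by simp
qed

lemma Ebar_cover: "cblkG C j \<in> (\<Union>k\<in>workers. Ebar C k)"
  using blkG[of j] km_worker[OF blkG[of j]] by (auto simp: Ebar_def)

lemma sum_vk: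
  assumes X: "H_local X"
  shows "(\<Sum>k\<in>workers. vk C X k) = cD C *v assemble X"
proof -
  have "(\<Sum>k\<in>workers. vk C X k) = (\<Sum>k\<in>workers. resG (Ebar C k) (cD C *v assemble X))"
    by (intro sum.cong refl vk_eq[OF X])
  also have "\<dots> = cD C *v assemble X"
    using Ebar_cover by (simp add: sum_resV_disjoint Ebar_disjoint resV_cover_eq)
  finally show ?thesis .
qed

lemma dA_eq:
  assumes X: "H_local X"
    and Z: "G_local Z"
    and U: "G_local U"
    and m: "m \<in> hyperedges"
  shows "dA C \<alpha> X Z U m
       = resG {m} ((1 / \<alpha>^2) *\<^sub>R (cD C *v assemble X - (assemble Z - assemble U)))"
  unfolding dA_def resV_diff resV_scaleR vA_eq[OF X m]
    resG_edge_assemble[OF Z m] resG_edge_assemble[OF U m] ..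

lemma sum_Ebar_swap:
  "(\<Sum>k\<in>workers. \<Sum>m\<in>Ebar C k. F k m) = (\<Sum>m\<in>hyperedges. F (ckm C m) m)"
proof -
  have "(\<Sum>k\<in>workers. \<Sum>m\<in>Ebar C k. F k m)
      = (\<Sum>k\<in>workers. \<Sum>m\<in>{m. m \<in> hyperedges \<and> ckm C m = k}. F k m)"
    by (simp add: Ebar_def)
  also have "\<dots> = (\<Sum>m\<in>hyperedges. \<Sum>k\<in>{k. k \<in> workers \<and> ckm C m = k}. F k m)"
    by (rule sum.swap_restrict) auto
  also have "\<dots> = (\<Sum>m\<in>hyperedges. F (ckm C m) m)"
  proof (rule sum.cong[OF refl])
    fix m assume "m \<in> hyperedges"
    then have "{k. k \<in> workers \<and> ckm C m = k} = {ckm C m}" using km_worker by auto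
    then show "(\<Sum>k\<in>{k. k \<in> workers \<and> ckm C m = k}. F k m) = F (ckm C m) m" by simp
  qed
  finally show ?thesis .
qed

lemma Sset_Epair_eq: "k \<in> workers \<Longrightarrow> (\<Union>k'\<in>Sset C k. Epair C k' k) = {m \<in> hyperedges. k \<in> Wset C m}"
  using km_worker by (auto simp: Sset_def Rset_def Epair_def Ebar_def Wset_def)

lemma sum_Sset_Epair_swap:
  "(\<Sum>k\<in>workers. \<Sum>k'\<in>Sset C k. \<Sum>m\<in>Epair C k' k. F k m) = (\<Sum>m\<in>hyperedges. \<Sum>k\<in>Wset C m. F k m)"
proof -
  have "(\<Sum>k'\<in>Sset C k. \<Sum>m\<in>Epair C k' k. F k m) = (\<Sum>m\<in>{m \<in> hyperedges. k \<in> Wset C m}. F k m)"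
    if "k \<in> workers" for k
    by (subst Sset_Epair_eq[OF that, symmetric], rule sum.UNION_disjoint[symmetric])
      (auto simp: Epair_def Ebar_def)
  then have "(\<Sum>k\<in>workers. \<Sum>k'\<in>Sset C k. \<Sum>m\<in>Epair C k' k. F k m)
      = (\<Sum>k\<in>workers. \<Sum>m\<in>{m \<in> hyperedges. k \<in> Wset C m}. F k m)"
    by simp
  also have "\<dots> = (\<Sum>m\<in>hyperedges. \<Sum>k\<in>{k \<in> workers. k \<in> Wset C m}. F k m)"
    by (rule sum.swap_restrict) auto
  also have "\<dots> = (\<Sum>m\<in>hyperedges. \<Sum>k\<in>Wset C m. F k m)"
    by (intro sum.cong refl) (auto simp: Wset_def)
  finally show ?thesis .
qed

lemma sum_resH_adjoint_edge:
  assumes m: "m \<in> hyperedges"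
  shows "(\<Sum>k\<in>workers. resH (cV C k) (transpose (cD C) *v resG {m} d))
    = resH (cV C (ckm C m)) (transpose (cD C) *v resG {m} d)
      + (\<Sum>k\<in>Wset C m. resH (cV C k) (transpose (cD C) *v resG {m} d))"
proof -
  let ?F = "\<lambda>k. resH (cV C k) (transpose (cD C) *v resG {m} d)"
  let ?I = "insert (ckm C m) (Wset C m)"
  have sub: "?I \<subseteq> workers" using km_worker[OF m] by (auto simp: Wset_def)
  have "sum ?F workers = sum ?F ?I"
  proof (rule sum.mono_neutral_right[OF _ sub])
    show "\<forall>k\<in>workers - ?I. ?F k = 0"
    proof
      fix k assume "k \<in> workers - ?I"
      then have "cV C k \<inter> hedge C m = {}" by (auto simp: Wset_def)
      then show "?F k = 0" by (rule resH_Dt_edge_vanish)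
    qed
  qed simp
  also have "\<dots> = ?F (ckm C m) + sum ?F (Wset C m)"
    by (rule sum.insert) (auto simp: Wset_def)
  finally show ?thesis .
qed

lemma sum_deltaA:
  assumes X: "H_local X"
    and Z: "G_local Z"
    and U: "G_local U"
  shows "(\<Sum>k\<in>workers. deltaA C \<alpha> X Z U k)
       = transpose (cD C) *v ((1 / \<alpha>^2) *\<^sub>R (cD C *v assemble X - (assemble Z - assemble U)))"
proof -
  define y where "y = (1 / \<alpha>^2) *\<^sub>R (cD C *v assemble X - (assemble Z - assemble U))"
  define E where "E m = transpose (cD C) *v resG {m} y" for m
  have adj: "subadj C m A (dA C \<alpha> X Z U m) = resH A (E m)" if "m \<in> hyperedges" for m A
    unfolding subadj_def dA_eq[OF X Z U that] E_def y_def by (simp only: resV_resV Int_absorb)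
  have "deltaA C \<alpha> X Z U k = (\<Sum>m\<in>Ebar C k. resH (cV C k) (E m))
      + (\<Sum>k'\<in>Sset C k. \<Sum>m\<in>Epair C k' k. resH (cV C k) (E m))" for k
    unfolding deltaA_def dtil_def
    by (intro arg_cong2[where f="(+)"] sum.cong refl adj) (auto simp: Ebar_def Epair_def)
  then have "(\<Sum>k\<in>workers. deltaA C \<alpha> X Z U k)
     = (\<Sum>m\<in>hyperedges. resH (cV C (ckm C m)) (E m) + (\<Sum>k\<in>Wset C m. resH (cV C k) (E m)))"
    by (simp add: sum.distrib sum_Ebar_swap sum_Sset_Epair_swap)
  also have "\<dots> = (\<Sum>m\<in>hyperedges. \<Sum>k\<in>workers. resH (cV C k) (E m))"
    unfolding E_def by (intro sum.cong refl sum_resH_adjoint_edge[symmetric])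
  also have "\<dots> = (\<Sum>m\<in>hyperedges. E m)"
    using worker_of_coordinate by (simp add: sum_resV_disjoint V_disjoint resV_cover_eq)
  also have "\<dots> = transpose (cD C) *v (\<Sum>m\<in>hyperedges. resG {m} y)"
    by (simp add: E_def linear_sum[OF matrix_vector_mul_linear] o_def)
  also have "\<dots> = transpose (cD C) *v y"
    using blkG by (simp add: sum_resV_disjoint singletons_disjoint resV_cover_eq)
  finally show ?thesis unfolding y_def .
qed

lemma phi_eq_norm: "phi C \<alpha> v c = norm (v - c) ^ 2 / (2 * \<alpha>^2)"
proof -
  have "norm (v - c) ^ 2 = (\<Sum>m\<in>hyperedges. norm (resG {m} (v - c)) ^ 2)"
    using blkG by (intro norm_square_sum_resV) (auto simp: singletons_disjoint)
  then show ?thesis by (simp add: phi_def sum_divide_distrib)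
qed

lemma grad_phi: "grad (\<lambda>v. phi C \<alpha> v c) v0 = (1 / \<alpha>^2) *\<^sub>R (v0 - c)"
proof (rule grad_eqI)
  have "((\<lambda>v. (1 / (2 * \<alpha>^2)) * ((v - c) \<bullet> (v - c))) has_derivative
      (\<lambda>d. (1 / (2 * \<alpha>^2)) * ((v0 - c) \<bullet> (d - 0) + (d - 0) \<bullet> (v0 - c)))) (at v0)"
    by (intro has_derivative_mult_right has_derivative_inner has_derivative_diff
        has_derivative_ident has_derivative_const)
  moreover have "(\<lambda>d. (1 / (2 * \<alpha>^2)) * ((v0 - c) \<bullet> (d - 0) + (d - 0) \<bullet> (v0 - c)))
      = (\<lambda>d. ((1 / \<alpha>^2) *\<^sub>R (v0 - c)) \<bullet> d)"
    by (rule ext) (simp add: inner_commute)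
  moreover have "(\<lambda>v. phi C \<alpha> v c) = (\<lambda>v. (1 / (2 * \<alpha>^2)) * ((v - c) \<bullet> (v - c)))"
    by (simp add: phi_eq_norm power2_norm_eq_inner)
  ultimately show "((\<lambda>v. phi C \<alpha> v c) has_derivative (\<lambda>d. ((1 / \<alpha>^2) *\<^sub>R (v0 - c)) \<bullet> d)) (at v0)"
    by simp
qed

section \<open>Separable functions\<close>

context
  fixes h :: "real^'h \<Rightarrow> real" and hk :: "nat \<Rightarrow> real^'h \<Rightarrow> real"
  assumes h_sep: "\<And>x. h x = (\<Sum>k\<in>workers. hk k (resH (cV C k) x))"
    and h_diff: "\<And>x. h differentiable (at x)"
begin

lemma h_on_block:
  assumes k: "k \<in> workers"
  shows "hk k (resH (cV C k) y) = h (resH (cV C k) y) - (\<Sum>k'\<in>workers - {k}. hk k' 0)"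
proof -
  have "resH (cV C k') (resH (cV C k) y) = 0" if "k' \<in> workers - {k}" for k'
    using disjoint_family_onD[OF V_disjoint, of k' k] k that by (simp add: resV_resV vec_eq_iff)
  then have "h (resH (cV C k) y) = hk k (resH (cV C k) y) + (\<Sum>k'\<in>workers - {k}. hk k' 0)"
    using k by (simp add: h_sep sum.remove resV_resV)
  then show ?thesis by simp
qed

lemma has_derivative_block:
  assumes k: "k \<in> workers"
  shows "((\<lambda>y. hk k (resH (cV C k) y)) has_derivative
           (\<lambda>d. resH (cV C k) (grad h (resH (cV C k) y)) \<bullet> d)) (at y)"
proof -
  have "((\<lambda>y. h (resH (cV C k) y)) has_derivative (\<lambda>d. grad h (resH (cV C k) y) \<bullet> resH (cV C k) d)) (at y)"
    by (rule has_derivative_compose[OF bounded_linear_imp_has_derivative[OF bounded_linear_resV]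
          has_derivative_grad[OF h_diff]])
  then have "((\<lambda>y. h (resH (cV C k) y) - (\<Sum>k'\<in>workers - {k}. hk k' 0)) has_derivative
      (\<lambda>d. grad h (resH (cV C k) y) \<bullet> resH (cV C k) d - 0)) (at y)"
    by (intro has_derivative_diff has_derivative_const)
  then show ?thesis by (simp add: h_on_block[OF k] inner_resV)
qed

lemma grad_block:
  "k \<in> workers \<Longrightarrow> grad (\<lambda>y. hk k (resH (cV C k) y)) y = resH (cV C k) (grad h (resH (cV C k) y))"
  by (rule grad_eqI[OF has_derivative_block])

lemma grad_separable:
  assumes X: "H_local X"
  shows "grad h (assemble X) = (\<Sum>k\<in>workers. grad (\<lambda>y. hk k (resH (cV C k) y)) (X k))"
proof (rule grad_eqI)
  have block: "grad (\<lambda>y. hk k (resH (cV C k) y)) (X k) = resH (cV C k) (grad h (resH (cV C k) (assemble X)))"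
    if "k \<in> workers" for k
    using that X by (simp add: grad_block resH_assemble resV_subsp_eq H_local_def)
  have "((\<lambda>x. \<Sum>k\<in>workers. hk k (resH (cV C k) x)) has_derivative
     (\<lambda>d. \<Sum>k\<in>workers. resH (cV C k) (grad h (resH (cV C k) (assemble X))) \<bullet> d)) (at (assemble X))"
    by (intro has_derivative_sum has_derivative_block)
  then show "(h has_derivative (\<lambda>d. (\<Sum>k\<in>workers. grad (\<lambda>y. hk k (resH (cV C k) y)) (X k)) \<bullet> d)) (at (assemble X))"
    by (simp add: h_sep[abs_def] block inner_sum_left)
qed

end

context
  fixes f :: "real^'h \<Rightarrow> ereal" and fk :: "nat \<Rightarrow> real^'h \<Rightarrow> ereal"
  assumes f_sep: "\<And>x. f x = (\<Sum>k\<in>workers. fk k (resH (cV C k) x))"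
begin

lemma prox_objective_separable:
  assumes a: "H_local a"
  shows "f z + ereal (norm (z - assemble a)^2 / (2*\<gamma>)) =
     (\<Sum>k\<in>workers. fk k (resH (cV C k) z) + ereal (norm (resH (cV C k) z - a k)^2 / (2*\<gamma>)))"
proof -
  have "norm (z - assemble a)^2 = (\<Sum>k\<in>workers. norm (resH (cV C k) (z - assemble a))^2)"
    using worker_of_coordinate by (intro norm_square_sum_resV) (auto simp: V_disjoint)
  also have "\<dots> = (\<Sum>k\<in>workers. norm (resH (cV C k) z - a k)^2)"
    using a by (simp add: resV_diff resH_assemble)
  finally have "ereal (norm (z - assemble a)^2 / (2*\<gamma>))
      = (\<Sum>k\<in>workers. ereal (norm (resH (cV C k) z - a k)^2 / (2*\<gamma>)))"
    by (simp add: sum_divide_distrib)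
  then show ?thesis by (simp add: f_sep sum.distrib)
qed

lemma prox_on_separable:
  assumes a: "H_local a"
    and y: "\<And>k. k \<in> workers \<Longrightarrow> y k \<in> prox_on (subsp (cblkH C) (cV C k)) \<gamma> (fk k) (a k)"
  shows "assemble y \<in> prox_on UNIV \<gamma> f (assemble a)"
  unfolding prox_on_def
proof (intro CollectI conjI ballI UNIV_I)
  fix z :: "real^'h"
  have "H_local y" using y by (auto simp: prox_on_def H_local_def)
  then have "f (assemble y) + ereal (norm (assemble y - assemble a)^2 / (2*\<gamma>))
       = (\<Sum>k\<in>workers. fk k (y k) + ereal (norm (y k - a k)^2 / (2*\<gamma>)))"
    by (simp add: prox_objective_separable[OF a] resH_assemble)
  also have "\<dots> \<le> (\<Sum>k\<in>workers. fk k (resH (cV C k) z) + ereal (norm (resH (cV C k) z - a k)^2 / (2*\<gamma>)))"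
  proof (rule sum_mono)
    fix k assume "k \<in> workers"
    then show "fk k (y k) + ereal (norm (y k - a k)^2 / (2*\<gamma>))
        \<le> fk k (resH (cV C k) z) + ereal (norm (resH (cV C k) z - a k)^2 / (2*\<gamma>))"
      using y resV_in_subsp unfolding prox_on_def by blast
  qed
  also have "\<dots> = f z + ereal (norm (z - assemble a)^2 / (2*\<gamma>))"
    by (simp add: prox_objective_separable[OF a])
  finally show "f (assemble y) + ereal (norm (assemble y - assemble a)^2 / (2*\<gamma>))
      \<le> f z + ereal (norm (z - assemble a)^2 / (2*\<gamma>))" .
qed

end

end

section \<open>Runs of the distributed algorithm\<close>

locale distributed_run = block_partition C
  for C :: "('h::finite, 'g::finite) cfg" +
  fixes \<alpha> \<beta> \<gamma> :: real and T :: nat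
    and h :: "real^'h \<Rightarrow> real" and hk :: "nat \<Rightarrow> real^'h \<Rightarrow> real"
    and f :: "real^'h \<Rightarrow> ereal" and fk :: "nat \<Rightarrow> real^'h \<Rightarrow> ereal"
    and xk :: "nat \<Rightarrow> nat \<Rightarrow> real^'h" and zk uk :: "nat \<Rightarrow> nat \<Rightarrow> real^'g"
    and w :: "nat \<Rightarrow> nat \<Rightarrow> real^'h" and \<zeta> :: "nat \<Rightarrow> nat \<Rightarrow> real^'g"
    and \<xi> :: "nat \<Rightarrow> nat \<Rightarrow> 'r"
    and samp :: "nat \<Rightarrow> real^'g \<Rightarrow> real^'g \<Rightarrow> real^'g \<Rightarrow> 'r \<Rightarrow> real^'g"
  assumes h_diff: "\<And>x. h differentiable (at x)"
    and h_sep: "\<And>x. h x = (\<Sum>k\<in>workers. hk k (resH (cV C k) x))"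
    and f_sep: "\<And>x. f x = (\<Sum>k\<in>workers. fk k (resH (cV C k) x))"
    and samp_sub: "\<And>k v z u r. samp k v z u r \<in> subsp (cblkG C) (Ebar C k)"
    and init: "\<And>k. k \<in> workers \<Longrightarrow> xk k 0 \<in> subsp (cblkH C) (cV C k)
                  \<and> zk k 0 \<in> subsp (cblkG C) (Ebar C k) \<and> uk k 0 \<in> subsp (cblkG C) (Ebar C k)"
    and noise_sub: "\<And>k t. k \<in> workers \<Longrightarrow> w k t \<in> subsp (cblkH C) (cV C k)
                  \<and> \<zeta> k t \<in> subsp (cblkG C) (Ebar C k)"
    and step_x: "\<And>k t. k \<in> workers \<Longrightarrow> t \<le> T \<Longrightarrow>
        xk k (Suc t) \<in> prox_on (subsp (cblkH C) (cV C k)) \<gamma> (fk k)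
          (xk k t - \<gamma> *\<^sub>R grad (\<lambda>y. hk k (resH (cV C k) y)) (xk k t)
             - \<gamma> *\<^sub>R deltaA C \<alpha> (\<lambda>j. xk j t) (\<lambda>j. zk j t) (\<lambda>j. uk j t) k
             + sqrt (2*\<gamma>) *\<^sub>R w k t)"
    and step_z: "\<And>k t. k \<in> workers \<Longrightarrow> t \<le> T \<Longrightarrow>
        zk k (Suc t) = samp k (vk C (\<lambda>j. xk j (Suc t)) k) (zk k t) (uk k t) (\<xi> k t)"
    and step_u: "\<And>k t. k \<in> workers \<Longrightarrow> t \<le> T \<Longrightarrow>
        uk k (Suc t) = (\<beta>^2 / (\<alpha>^2 + \<beta>^2)) *\<^sub>R (zk k (Suc t) - vk C (\<lambda>j. xk j (Suc t)) k)
          + sqrt ((\<alpha>^2 + \<beta>^2) / (\<alpha>^2 * \<beta>^2)) *\<^sub>R \<zeta> k t"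
begin

abbreviation "X t \<equiv> assemble (\<lambda>k. xk k t)"
abbreviation "Z t \<equiv> assemble (\<lambda>k. zk k t)"
abbreviation "U t \<equiv> assemble (\<lambda>k. uk k t)"
abbreviation "W t \<equiv> assemble (\<lambda>k. w k t)"
abbreviation "Zeta t \<equiv> assemble (\<lambda>k. \<zeta> k t)"

lemma x_local: "t \<le> Suc T \<Longrightarrow> H_local (\<lambda>k. xk k t)"
  using init step_x by (cases t) (auto simp: H_local_def prox_on_def)

lemma vk_run_eq: "t \<le> Suc T \<Longrightarrow> vk C (\<lambda>j. xk j t) k = resG (Ebar C k) (cD C *v X t)"
  by (rule vk_eq[OF x_local])

lemma z_local: "t \<le> Suc T \<Longrightarrow> G_local (\<lambda>k. zk k t)"
  using init step_z samp_sub by (cases t) (auto simp: G_local_def)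

lemma u_local:
  assumes t: "t \<le> Suc T"
  shows "G_local (\<lambda>k. uk k t)"
proof (cases t)
  case 0
  then show ?thesis using init by (simp add: G_local_def)
next
  case (Suc s)
  with t have s: "s \<le> T" by simp
  have "uk k (Suc s) \<in> subsp (cblkG C) (Ebar C k)" if k: "k \<in> workers" for k
    unfolding step_u[OF k s] vk_run_eq[OF t[unfolded Suc]]
    using z_local[OF t] noise_sub[OF k] k Suc
    by (intro subspace_add subspace_scale subspace_diff subspace_subsp resV_in_subsp)
      (auto simp: G_local_def)
  with Suc show ?thesis by (simp add: G_local_def)
qed

lemma sum_vk_run: "t \<le> Suc T \<Longrightarrow> (\<Sum>k\<in>workers. vk C (\<lambda>j. xk j t) k) = cD C *v X t"
  by (rule sum_vk[OF x_local])

lemma sum_deltaA_run: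
  "t \<le> T \<Longrightarrow> (\<Sum>k\<in>workers. deltaA C \<alpha> (\<lambda>j. xk j t) (\<lambda>j. zk j t) (\<lambda>j. uk j t) k)
      = transpose (cD C) *v grad (\<lambda>v. phi C \<alpha> v (Z t - U t)) (cD C *v X t)"
  unfolding grad_phi by (rule sum_deltaA[OF x_local z_local u_local]) simp_all

lemma x_step:
  assumes t: "t \<le> T"
  shows "X (Suc t) \<in> prox_on UNIV \<gamma> f
      (X t - \<gamma> *\<^sub>R grad h (X t)
        - \<gamma> *\<^sub>R (transpose (cD C) *v grad (\<lambda>v. phi C \<alpha> v (Z t - U t)) (cD C *v X t))
        + sqrt (2*\<gamma>) *\<^sub>R W t)"
proof -
  let ?g = "\<lambda>k. grad (\<lambda>y. hk k (resH (cV C k) y)) (xk k t)"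
  let ?\<delta> = "\<lambda>k. deltaA C \<alpha> (\<lambda>j. xk j t) (\<lambda>j. zk j t) (\<lambda>j. uk j t) k"
  define a where "a k = xk k t - \<gamma> *\<^sub>R ?g k - \<gamma> *\<^sub>R ?\<delta> k + sqrt (2*\<gamma>) *\<^sub>R w k t" for k
  have "a k \<in> subsp (cblkH C) (cV C k)" if k: "k \<in> workers" for k
  proof -
    have "?g k \<in> subsp (cblkH C) (cV C k)" by (simp add: grad_block[OF h_sep h_diff k] resV_in_subsp)
    moreover have "?\<delta> k \<in> subsp (cblkH C) (cV C k)"
      unfolding deltaA_def dtil_def subadj_def
      by (intro subspace_add subspace_sum subspace_subsp resV_in_subsp)
    ultimately show ?thesis
      unfolding a_def using x_local t k noise_sub[OF k]
      by (intro subspace_add subspace_scale subspace_diff subspace_subsp) (auto simp: H_local_def)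
  qed
  then have "X (Suc t) \<in> prox_on UNIV \<gamma> f (assemble a)"
    using step_x t unfolding a_def
    by (intro prox_on_separable[where f=f and fk=fk, OF f_sep]) (auto simp: H_local_def)
  moreover have "(\<Sum>k\<in>workers. ?g k) = grad h (X t)"
    using grad_separable[OF h_sep h_diff x_local] t by simp
  moreover have "assemble a = X t - \<gamma> *\<^sub>R (\<Sum>k\<in>workers. ?g k) - \<gamma> *\<^sub>R (\<Sum>k\<in>workers. ?\<delta> k) + sqrt (2*\<gamma>) *\<^sub>R W t"
    by (simp add: a_def sum.distrib sum_subtractf scaleR_sum_right)
  ultimately show ?thesis using sum_deltaA_run[OF t] by simp
qed

lemma z_step:
  assumes t: "t \<le> T"
  shows "Z (Suc t) = Kprod C samp (cD C *v X (Suc t)) (Z t) (U t) (\<lambda>k. \<xi> k t)"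
  unfolding Kprod_def Let_def
proof (rule sum.cong[OF refl])
  fix k assume k: "k \<in> workers"
  show "zk k (Suc t) = samp k (resG (Ebar C k) (cD C *v X (Suc t))) (resG (Ebar C k) (Z t))
          (resG (Ebar C k) (U t)) (\<xi> k t)"
    using t by (simp add: step_z[OF k t] vk_run_eq resG_assemble[OF z_local k] resG_assemble[OF u_local k])
qed

lemma u_step:
  assumes t: "t \<le> T"
  shows "U (Suc t) = (\<beta>^2 / (\<alpha>^2 + \<beta>^2)) *\<^sub>R (Z (Suc t) - cD C *v X (Suc t))
      + sqrt ((\<alpha>^2 + \<beta>^2) / (\<alpha>^2 * \<beta>^2)) *\<^sub>R Zeta t"
proof -
  have "U (Suc t) = (\<beta>^2 / (\<alpha>^2 + \<beta>^2)) *\<^sub>R (Z (Suc t) - (\<Sum>k\<in>workers. vk C (\<lambda>j. xk j (Suc t)) k))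
      + sqrt ((\<alpha>^2 + \<beta>^2) / (\<alpha>^2 * \<beta>^2)) *\<^sub>R Zeta t"
    using t by (simp add: step_u sum.distrib sum_subtractf scaleR_sum_right scaleR_diff_right)
  then show ?thesis using sum_vk_run t by simp
qed

end

theorem proposition2:
  fixes C :: "('h::finite, 'g::finite) cfg"
    and \<alpha> \<beta> \<gamma> lh :: real and T :: nat
    and h :: "real^'h \<Rightarrow> real" and hk :: "nat \<Rightarrow> real^'h \<Rightarrow> real"
    and f :: "real^'h \<Rightarrow> ereal" and fk :: "nat \<Rightarrow> real^'h \<Rightarrow> ereal"
    and g :: "real^'g \<Rightarrow> ereal" and gm :: "nat \<Rightarrow> real^'g \<Rightarrow> ereal"
    and xk :: "nat \<Rightarrow> nat \<Rightarrow> real^'h" and zk uk :: "nat \<Rightarrow> nat \<Rightarrow> real^'g"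
    and w :: "nat \<Rightarrow> nat \<Rightarrow> real^'h" and \<zeta> :: "nat \<Rightarrow> nat \<Rightarrow> real^'g"
    and \<xi> :: "nat \<Rightarrow> nat \<Rightarrow> 'r"
    and samp :: "nat \<Rightarrow> real^'g \<Rightarrow> real^'g \<Rightarrow> real^'g \<Rightarrow> 'r \<Rightarrow> real^'g"
  assumes blkH: "\<And>i. cblkH C i \<in> {1..cN C}" "\<And>n. n \<in> {1..cN C} \<Longrightarrow> \<exists>i. cblkH C i = n"
    and blkG: "\<And>j. cblkG C j \<in> {1..cM C}" "\<And>m. m \<in> {1..cM C} \<Longrightarrow> \<exists>j. cblkG C j = m"
    and K_pos: "1 \<le> cK C" and K_le: "cK C \<le> cN C"
    and V_nonempty: "\<And>k. k \<in> {1..cK C} \<Longrightarrow> cV C k \<noteq> {}"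
    and V_cover: "(\<Union>k \<in> {1..cK C}. cV C k) = {1..cN C}"
    and V_disj: "\<And>k k'. k \<in> {1..cK C} \<Longrightarrow> k' \<in> {1..cK C} \<Longrightarrow> k \<noteq> k' \<Longrightarrow> cV C k \<inter> cV C k' = {}"
    and km: "\<And>m. m \<in> {1..cM C} \<Longrightarrow> ckm C m \<in> {1..cK C} \<and> hedge C m \<inter> cV C (ckm C m) \<noteq> {}"
    and \<alpha>: "\<alpha> > 0" and \<beta>: "\<beta> > 0"
    and h_diff: "\<And>x. h differentiable (at x)"
    and h_lip: "lh > 0" "\<And>x y. norm (grad h x - grad h y) \<le> lh * norm (x - y)"
    and h_sep: "\<And>x. h x = (\<Sum>k = 1..cK C. hk k (resV (cblkH C) (cV C k) x))"
    and f_sep: "\<And>x. f x = (\<Sum>k = 1..cK C. fk k (resV (cblkH C) (cV C k) x))"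
    and fk_val: "\<And>k x. fk k x \<noteq> -\<infinity>"
    and g_sep: "\<And>v. g v = (\<Sum>m = 1..cM C. gm m (resV (cblkG C) {m} v))"
    and gm_val: "\<And>m v. gm m v \<noteq> -\<infinity>"
    and \<gamma>: "0 < \<gamma>" "\<gamma> < 1 / (lh + (onorm (\<lambda>x. cD C *v x))^2 / \<alpha>^2)"
    and samp_sub: "\<And>k v z u r. samp k v z u r \<in> subsp (cblkG C) (Ebar C k)"
    and init: "\<And>k. k \<in> {1..cK C} \<Longrightarrow> xk k 0 \<in> subsp (cblkH C) (cV C k)
                  \<and> zk k 0 \<in> subsp (cblkG C) (Ebar C k) \<and> uk k 0 \<in> subsp (cblkG C) (Ebar C k)"
    and noise_sub: "\<And>k t. k \<in> {1..cK C} \<Longrightarrow> w k t \<in> subsp (cblkH C) (cV C k)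
                  \<and> \<zeta> k t \<in> subsp (cblkG C) (Ebar C k)"
    and step_x: "\<And>k t. k \<in> {1..cK C} \<Longrightarrow> t \<le> T \<Longrightarrow>
        xk k (Suc t) \<in> prox_on (subsp (cblkH C) (cV C k)) \<gamma> (fk k)
          (xk k t - \<gamma> *\<^sub>R grad (\<lambda>y. hk k (resV (cblkH C) (cV C k) y)) (xk k t)
             - \<gamma> *\<^sub>R deltaA C \<alpha> (\<lambda>j. xk j t) (\<lambda>j. zk j t) (\<lambda>j. uk j t) k
             + sqrt (2*\<gamma>) *\<^sub>R w k t)"
    and step_z: "\<And>k t. k \<in> {1..cK C} \<Longrightarrow> t \<le> T \<Longrightarrow>
        zk k (Suc t) = samp k (vk C (\<lambda>j. xk j (Suc t)) k) (zk k t) (uk k t) (\<xi> k t)"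
    and step_u: "\<And>k t. k \<in> {1..cK C} \<Longrightarrow> t \<le> T \<Longrightarrow>
        uk k (Suc t) = (\<beta>^2 / (\<alpha>^2 + \<beta>^2)) *\<^sub>R (zk k (Suc t) - vk C (\<lambda>j. xk j (Suc t)) k)
          + sqrt ((\<alpha>^2 + \<beta>^2) / (\<alpha>^2 * \<beta>^2)) *\<^sub>R \<zeta> k t"
  shows "let x = (\<lambda>t. \<Sum>k = 1..cK C. xk k t); z = (\<lambda>t. \<Sum>k = 1..cK C. zk k t);
             u = (\<lambda>t. \<Sum>k = 1..cK C. uk k t); W = (\<lambda>t. \<Sum>k = 1..cK C. w k t);
             Zeta = (\<lambda>t. \<Sum>k = 1..cK C. \<zeta> k t); D = cD C
         in (\<forall>t \<le> Suc T. (\<Sum>k = 1..cK C. vk C (\<lambda>j. xk j t) k) = D *v x t)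
          \<and> (\<forall>t \<le> T. (\<Sum>k = 1..cK C. deltaA C \<alpha> (\<lambda>j. xk j t) (\<lambda>j. zk j t) (\<lambda>j. uk j t) k)
                 = transpose D *v grad (\<lambda>v. phi C \<alpha> v (z t - u t)) (D *v x t))
          \<and> (\<forall>t \<le> T.
               x (Suc t) \<in> prox_on UNIV \<gamma> f
                 (x t - \<gamma> *\<^sub>R grad h (x t)
                   - \<gamma> *\<^sub>R (transpose D *v grad (\<lambda>v. phi C \<alpha> v (z t - u t)) (D *v x t))
                   + sqrt (2*\<gamma>) *\<^sub>R W t)
             \<and> z (Suc t) = Kprod C samp (D *v x (Suc t)) (z t) (u t) (\<lambda>k. \<xi> k t)
             \<and> u (Suc t) = (\<beta>^2 / (\<alpha>^2 + \<beta>^2)) *\<^sub>R (z (Suc t) - D *v x (Suc t))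
                 + sqrt ((\<alpha>^2 + \<beta>^2) / (\<alpha>^2 * \<beta>^2)) *\<^sub>R Zeta t)"
proof -
  interpret distributed_run C \<alpha> \<beta> \<gamma> T h hk f fk xk zk uk w \<zeta> \<xi> samp
  proof unfold_locales
    show "disjoint_family_on (cV C) {1..cK C}"
      using V_disj by (simp add: disjoint_family_on_def)
    show "ckm C m \<in> {1..cK C}" if "m \<in> {1..cM C}" for m
      using km[OF that] ..
  qed (fact assms)+
  show ?thesis
    unfolding Let_def using sum_vk_run sum_deltaA_run x_step z_step u_step by blast
qed

end
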